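(* Let $g>0$ and let $f\in C^2(\mathbb{R})$ be $1$-periodic. Suppose that $$\max\dot f\ge \frac g2\quad\text{and}\quad \min\dot f\le-\frac g2 .$$ Let $P$ be the bouncing ball map associated with $f$ and $g$, written in the time-energy coordinates $(t,E)$ on $\mathbb{T}\times(\bar E,+\infty)$, where $\bar E$ is a fixed sufficiently large constant. Then there exist a sequence of compact sets $\mathcal{K}_i\subset\mathbb{T}\times(\bar E,+\infty)$ and a sequence of positive integers $Q_i$ such that, for every $i$, $P^{Q_i}$ leaves $\mathcal{K}_i$ invariant and is semi-conjugated to a Bernoulli shift when restricted to $\mathcal{K}_i$.
   Context: $\mathbb{T}=\mathbb{R}/\mathbb{Z}$, and $g>0$ is the gravity constant. For $t_1\ne t_0$ put $f[t_1,t_0]=\frac{f(t_1)-f(t_0)}{t_1-t_0}$. The function $f$ describes the vertical motion of a racket on which a ball, subject only to gravity, bounces elastically. The bouncing ball map in time-velocity coordinates sends $(t_0,v_0)$ (impact time and velocity immediately after impact) to $(t_1,v_1)$, where $$t_1=t_0+\tfrac2g v_0-\tfrac2g f[t_1,t_0]+\tfrac2g\dot f(t_0),\qquad v_1=v_0+\dot f(t_1)-2f[t_1,t_0]+\dot f(t_0).$$ This map is well defined for $v_0>\bar v$, for some sufficiently large $\bar v$; it commutes with $t\mapsto t+1$ and so is defined on $\mathbb{T}\times(\bar v,+\infty)$. In the coordinates $(t,E)$ with $E=\frac12v^2$ (and $v>0$) this gives the map $P(t_0,E_0)=(t_1,E_1)$, defined on $\mathbb{T}\times(\bar E,+\infty)$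 for $\bar E$ sufficiently large, with $E_i=\frac12v_i^2$. Iterates: $P^{Q}(x)$ is defined when $x,P(x),\dots,P^{Q-1}(x)$ all lie in $\mathbb{T}\times(\bar E,+\infty)$. "$P^{Q}$ leaves $\mathcal{K}$ invariant" means that $P^Q$ is defined on $\mathcal{K}$ and $P^Q(\mathcal{K})\subset\mathcal{K}$. The Bernoulli shift is $\sigma:\{0,1\}^{\mathbb{Z}}\to\{0,1\}^{\mathbb{Z}}$, $\sigma(e)_n=e_{n+1}$, with the product topology on $\{0,1\}^{\mathbb{Z}}$. "Semi-conjugated" means that there is a continuous surjective map $\varepsilon:\mathcal{K}\to\{0,1\}^{\mathbb{Z}}$ with $\varepsilon\circ P^{Q}=\sigma\circ\varepsilon$ on $\mathcal{K}$. *)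

theory Defs
  imports "HOL-Analysis.Analysis"
begin

section \<open>The circle \<open>\<real> / \<int>\<close>\<close>

quotient_type circle = real / "\<lambda>s t :: real. s - t \<in> \<int>"
  morphisms rep_circle to_circle
proof (rule equivpI)
  show "reflp (\<lambda>s t :: real. s - t \<in> \<int>)"
    by (simp add: reflp_def)
  show "symp (\<lambda>s t :: real. s - t \<in> \<int>)"
    by (metis (no_types, lifting) Ints_minus minus_diff_eq sympI)
  show "transp (\<lambda>s t :: real. s - t \<in> \<int>)"
  proof (rule transpI)
    fix x y z :: real assume "x - y \<in> \<int>" "y - z \<in> \<int>"
    then have "(x - y) + (y - z) \<in> \<int>" by (rule Ints_add)
    then show "x - z \<in> \<int>" by simp
  qed
qed

lemma to_circle_eq_iff: "to_circle s = to_circle t \<longleftrightarrow> s - t \<in> \<int>"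
  by (rule circle.abs_eq_iff)

lemma to_circle_rep [simp]: "to_circle (rep_circle x) = x"
  by (rule Quotient_abs_rep [OF Quotient_circle])

text \<open>The quotient topology. With it, \<^typ>\<open>circle \<times> real\<close> carries the library's product topology.\<close>

instantiation circle :: topological_space
begin

definition open_circle :: "circle set \<Rightarrow> bool" where
  "open_circle U \<longleftrightarrow> open (to_circle -` U)"

instance
  by standard (auto simp: open_circle_def vimage_Int vimage_Union)

end

lemma continuous_on_to_circle: "continuous_on A to_circle"
proof -
  have "continuous_on UNIV to_circle"
    by (simp add: continuous_on_open_vimage open_circle_def)
  then show ?thesis using continuous_on_subset by blast
qed


section \<open>The bouncing ball map\<close>

definition C2 :: "(real \<Rightarrow> real) \<Rightarrow> bool" where
  "C2 f \<longleftrightarrow> (\<forall>t. f differentiable at t) \<and> (\<forall>t. deriv f differentiable at t) \<and>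
     continuous_on UNIV (deriv (deriv f))"

definition div_diff :: "(real \<Rightarrow> real) \<Rightarrow> real \<Rightarrow> real \<Rightarrow> real" where
  "div_diff f t1 t0 = (f t1 - f t0) / (t1 - t0)"

text \<open>The equations linking consecutive impacts in time-velocity coordinates, with time lifted
  to \<open>\<real>\<close>. The first one is implicit in \<open>t1\<close>.\<close>

definition next_impact ::
  "real \<Rightarrow> (real \<Rightarrow> real) \<Rightarrow> real \<times> real \<Rightarrow> real \<times> real \<Rightarrow> bool" where
  "next_impact g f = (\<lambda>(t0, v0) (t1, v1). t1 \<noteq> t0 \<and>
     t1 = t0 + 2 / g * v0 - 2 / g * div_diff f t1 t0 + 2 / g * deriv f t0 \<and>
     v1 = v0 + deriv f t1 - 2 * div_diff f t1 t0 + deriv f t0)"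

definition bounce_tv :: "real \<Rightarrow> (real \<Rightarrow> real) \<Rightarrow> real \<times> real \<Rightarrow> real \<times> real" where
  "bounce_tv g f p = (THE q. next_impact g f p q)"

text \<open>\<open>Ebar\<close> is large enough: whenever \<open>v0 > 0\<close> has energy above \<open>Ebar\<close>, the equations determine
  the next impact uniquely, and the new velocity is again positive, so that \<open>(t, E)\<close> are
  coordinates at the image too. All sufficiently large \<open>Ebar\<close> qualify, see
  \<open>bounce_threshold_eventually\<close> below.\<close>

definition bounce_threshold :: "real \<Rightarrow> (real \<Rightarrow> real) \<Rightarrow> real \<Rightarrow> bool" where
  "bounce_threshold g f Ebar \<longleftrightarrow> Ebar \<ge> 0 \<and>
     (\<forall>t0 v0. v0 > 0 \<and> v0\<^sup>2 / 2 > Ebar \<longrightarrow>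
        (\<exists>!q. next_impact g f (t0, v0) q) \<and> snd (bounce_tv g f (t0, v0)) > 0)"

text \<open>The map \<open>P\<close>. For a 1-periodic \<open>f\<close> it does not depend on the representative of the time
  class, see \<open>bounce_map_to_circle\<close> below.\<close>

definition bounce_map :: "real \<Rightarrow> (real \<Rightarrow> real) \<Rightarrow> circle \<times> real \<Rightarrow> circle \<times> real" where
  "bounce_map g f = (\<lambda>(x, E0).
     let (t1, v1) = bounce_tv g f (rep_circle x, sqrt (2 * E0))
     in (to_circle t1, v1\<^sup>2 / 2))"

definition phase_space :: "real \<Rightarrow> (circle \<times> real) set" where
  "phase_space Ebar = UNIV \<times> {Ebar<..}"


section \<open>Invariance and semi-conjugacy\<close>

definition iterate_defined_on :: "'a set \<Rightarrow> ('a \<Rightarrow> 'a) \<Rightarrow> nat \<Rightarrow> 'a set \<Rightarrow> bool" where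
  "iterate_defined_on D P Q K \<longleftrightarrow> (\<forall>x\<in>K. \<forall>j<Q. (P ^^ j) x \<in> D)"

definition iterate_leaves_invariant :: "'a set \<Rightarrow> ('a \<Rightarrow> 'a) \<Rightarrow> nat \<Rightarrow> 'a set \<Rightarrow> bool" where
  "iterate_leaves_invariant D P Q K \<longleftrightarrow> iterate_defined_on D P Q K \<and> (P ^^ Q) ` K \<subseteq> K"

text \<open>\<open>{0,1}\<close> is encoded as \<^typ>\<open>bool\<close>, which has the discrete topology; the function type
  \<^typ>\<open>int \<Rightarrow> bool\<close> has the product topology.\<close>

definition bernoulli_shift :: "(int \<Rightarrow> bool) \<Rightarrow> (int \<Rightarrow> bool)" where
  "bernoulli_shift e = (\<lambda>n. e (n + 1))"

definition semiconj_bernoulli_on :: "('a :: topological_space \<Rightarrow> 'a) \<Rightarrow> 'a set \<Rightarrow> bool" where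
  "semiconj_bernoulli_on F K \<longleftrightarrow> (\<exists>\<epsilon> :: 'a \<Rightarrow> int \<Rightarrow> bool.
     continuous_on K \<epsilon> \<and> \<epsilon> ` K = UNIV \<and> (\<forall>x\<in>K. \<epsilon> (F x) = bernoulli_shift (\<epsilon> x)))"


section \<open>The bouncing ball map is well defined at high energies\<close>

lemma periodic_int:
  fixes f :: "real \<Rightarrow> real"
  assumes "\<And>t. f (t + 1) = f t" and "k \<in> \<int>"
  shows "f (t + k) = f t"
proof -
  interpret periodic_fun_simple' f by standard (rule assms(1))
  from assms(2) obtain n where "k = of_int n" by (auto elim: Ints_cases)
  then show ?thesis by (simp add: plus_of_int)
qed

lemma deriv_periodic_int:
  fixes f :: "real \<Rightarrow> real"
  assumes "\<And>t. f (t + 1) = f t" and "k \<in> \<int>"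
  shows "deriv f (t + k) = deriv f t"
proof -
  have "(f has_field_derivative D) (at (t + k)) \<longleftrightarrow> (f has_field_derivative D) (at t)" for D
    using periodic_int[of f, OF assms] by (simp add: DERIV_shift)
  then show ?thesis by (simp add: deriv_def)
qed

lemma deriv_bounded:
  fixes f :: "real \<Rightarrow> real"
  assumes "C2 f" and per: "\<And>t. f (t + 1) = f t"
  obtains M where "M > 0" "\<And>t. \<bar>deriv f t\<bar> \<le> M"
proof -
  have "continuous_on {0..1} (deriv f)"
    using assms(1) unfolding C2_def
    by (meson continuous_at_imp_continuous_on differentiable_imp_continuous_within)
  then have "bounded (deriv f ` {0..1})"
    by (intro compact_imp_bounded compact_continuous_image) auto
  then obtain M where M: "M > 0" "\<And>t. t \<in> {0..1} \<Longrightarrow> \<bar>deriv f t\<bar> \<le> M"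
    by (auto simp: bounded_pos)
  have "\<bar>deriv f t\<bar> \<le> M" for t
  proof -
    have "deriv f t = deriv f (frac t)"
      using deriv_periodic_int[of f, OF per, of "of_int \<lfloor>t\<rfloor>" "frac t"] by (simp add: frac_def)
    then show ?thesis using M(2)[of "frac t"] by (simp add: frac_lt_1 less_imp_le)
  qed
  with M(1) show thesis using that by blast
qed

lemma div_diff_bounded:
  assumes "C2 f" and M: "\<And>t. \<bar>deriv f t\<bar> \<le> M" and "s \<noteq> t"
  shows "\<bar>div_diff f s t\<bar> \<le> M"
proof -
  have D: "(f has_field_derivative deriv f x) (at x within UNIV)" for x
    using assms(1) by (simp add: C2_def DERIV_deriv_iff_real_differentiable)
  have "norm (f s - f t) \<le> M * norm (s - t)"
    by (rule field_differentiable_bound[of UNIV]) (use D M in auto)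
  then show ?thesis using \<open>s \<noteq> t\<close> by (simp add: div_diff_def divide_le_eq)
qed

lemma next_impact_shift:
  assumes per: "\<And>t. f (t + 1) = f t" and k: "k \<in> \<int>"
  shows "next_impact g f (t0 + k, v0) (t1 + k, v1) \<longleftrightarrow> next_impact g f (t0, v0) (t1, v1)"
proof -
  have "div_diff f (t1 + k) (t0 + k) = div_diff f t1 t0"
    by (simp add: div_diff_def periodic_int[of f, OF per k])
  then show ?thesis
    by (auto simp: next_impact_def deriv_periodic_int[of f, OF per k])
qed

lemma next_impact_unique_existence:
  assumes g: "g > 0" and f: "C2 f" and M0: "M > 0" and M: "\<And>t. \<bar>deriv f t\<bar> \<le> M"
    and v0: "v0 > 4 * M"
  shows "\<exists>!q. next_impact g f (t0, v0) q" and "snd (bounce_tv g f (t0, v0)) > 0"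
proof -
  define w where "w = v0 + deriv f t0"
  note dd = div_diff_bounded[OF f M]
  have w: "w \<ge> v0 - M" "w \<le> v0 + M" using M[of t0] by (auto simp: w_def)
  have eq: "t1 = t0 + 2 / g * v0 - 2 / g * div_diff f t1 t0 + 2 / g * deriv f t0 \<longleftrightarrow>
      g * (t1 - t0) / 2 + div_diff f t1 t0 = w" for t1
  proof -
    have "2 / g * v0 - 2 / g * div_diff f t1 t0 + 2 / g * deriv f t0 =
        2 / g * (w - div_diff f t1 t0)"
      by (simp add: w_def algebra_simps add_divide_distrib)
    moreover have "t1 - t0 = 2 / g * (w - div_diff f t1 t0) \<longleftrightarrow>
        g * (t1 - t0) / 2 + div_diff f t1 t0 = w"
      using g by (auto simp: field_simps)
    ultimately show ?thesis by linarith
  qed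
  define \<phi> where "\<phi> = (\<lambda>t. g * (t - t0) / 2 + div_diff f t t0)"
  define a where "a = t0 + 2 * (v0 - 2 * M) / g"
  define b where "b = t0 + 2 * (v0 + 2 * M) / g"
  have ab: "t0 < a" "a \<le> b" using g M0 v0 by (auto simp: a_def b_def divide_right_mono)
  have ga: "g * (a - t0) / 2 = v0 - 2 * M" and gb: "g * (b - t0) / 2 = v0 + 2 * M"
    using g by (auto simp: a_def b_def)
  have cf: "continuous_on {a..b} f"
    using f unfolding C2_def
    by (meson continuous_at_imp_continuous_on differentiable_imp_continuous_within)
  have "continuous_on {a..b} \<phi>"
    unfolding \<phi>_def div_diff_def using ab by (intro continuous_intros cf) auto
  moreover have "\<phi> a \<le> w"
    unfolding \<phi>_def ga using dd[of a t0] ab w by auto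
  moreover have "w \<le> \<phi> b"
    unfolding \<phi>_def gb using dd[of b t0] ab w by auto
  ultimately obtain t1 where t1: "a \<le> t1" "t1 \<le> b" "\<phi> t1 = w"
    using IVT'[of \<phi> a w b] ab by blast
  have uniq: "s = t" if s: "s \<noteq> t0" "\<phi> s = w" and t: "t \<noteq> t0" "\<phi> t = w" for s t
  proof (rule ccontr)
    assume "s \<noteq> t"
    have 1: "g * (s - t0) / 2 \<ge> w - M" "g * (t - t0) / 2 \<ge> w - M"
      using s t dd[of s t0] dd[of t t0] by (auto simp: \<phi>_def)
    have "g * (s - t0)^2 / 2 + (f s - f t0) = w * (s - t0)"
      "g * (t - t0)^2 / 2 + (f t - f t0) = w * (t - t0)"
      using s t by (auto simp: \<phi>_def div_diff_def field_simps power2_eq_square)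
    then have "(s - t) * (g * (s - t0) / 2 + g * (t - t0) / 2) + (f s - f t) = (s - t) * w"
      by (simp add: field_simps power2_eq_square)
    then have "g * (s - t0) / 2 + g * (t - t0) / 2 + div_diff f s t = w"
      using \<open>s \<noteq> t\<close> unfolding div_diff_def by (simp add: field_simps)
    with 1 dd[of s t] \<open>s \<noteq> t\<close> w v0 M0 show False by auto
  qed
  show ex1: "\<exists>!q. next_impact g f (t0, v0) q"
  proof (rule ex1I)
    show "next_impact g f (t0, v0)
      (t1, v0 + deriv f t1 - 2 * div_diff f t1 t0 + deriv f t0)"
      using t1 ab eq[of t1] by (auto simp: next_impact_def \<phi>_def)
  next
    fix q assume q: "next_impact g f (t0, v0) q"
    then have "fst q \<noteq> t0" "\<phi> (fst q) = w"
      using eq[of "fst q"] by (auto simp: next_impact_def \<phi>_def split: prod.splits)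
    then have "fst q = t1" using uniq t1 ab by force
    with q show "q = (t1, v0 + deriv f t1 - 2 * div_diff f t1 t0 + deriv f t0)"
      by (auto simp: next_impact_def split: prod.splits)
  qed
  have "next_impact g f (t0, v0) (bounce_tv g f (t0, v0))"
    unfolding bounce_tv_def by (rule theI'[OF ex1])
  then obtain s v where sv: "bounce_tv g f (t0, v0) = (s, v)" "s \<noteq> t0"
      "v = v0 + deriv f s - 2 * div_diff f s t0 + deriv f t0"
    by (auto simp: next_impact_def split: prod.splits)
  then show "snd (bounce_tv g f (t0, v0)) > 0"
    using M[of s] M[of t0] dd[of s t0] v0 by auto
qed

lemma bounce_threshold_eventually:
  assumes "g > 0" and "C2 f" and "\<And>t. f (t + 1) = f t"
  shows "\<forall>\<^sub>F Ebar in at_top. bounce_threshold g f Ebar"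
proof -
  obtain M where M: "M > 0" "\<And>t. \<bar>deriv f t\<bar> \<le> M"
    using deriv_bounded assms(2,3) by blast
  have "bounce_threshold g f Ebar" if E: "Ebar \<ge> 8 * M\<^sup>2" for Ebar
  proof -
    have "v0 > 4 * M" if "v0 > 0" "v0\<^sup>2 / 2 > Ebar" for v0
      using that E by (intro power2_less_imp_less[of "4 * M" v0]) (auto simp: power_mult_distrib)
    moreover have "Ebar \<ge> 0" using E by (meson order_trans zero_le_power2 mult_nonneg_nonneg zero_le_numeral)
    ultimately show ?thesis
      using next_impact_unique_existence[OF assms(1,2) M] by (auto simp: bounce_threshold_def)
  qed
  then show ?thesis by (auto simp: eventually_at_top_linorder)
qed

lemma bounce_map_to_circle:
  assumes per: "\<And>t. f (t + 1) = f t" and thr: "bounce_threshold g f Ebar"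
    and v0: "v0 > 0" "v0\<^sup>2 / 2 > Ebar" and imp: "next_impact g f (t0, v0) (t1, v1)"
  shows "bounce_map g f (to_circle t0, v0\<^sup>2 / 2) = (to_circle t1, v1\<^sup>2 / 2)"
proof -
  define r where "r = rep_circle (to_circle t0)"
  define k where "k = r - t0"
  have k: "k \<in> \<int>"
    unfolding k_def r_def by (metis to_circle_eq_iff to_circle_rep)
  have "next_impact g f (r, v0) (t1 + k, v1)"
    using next_impact_shift[of f, OF per k, of g t0 v0 t1 v1] imp by (simp add: k_def)
  moreover have "\<exists>!q. next_impact g f (r, v0) q"
    using thr v0 by (auto simp: bounce_threshold_def)
  ultimately have "bounce_tv g f (r, v0) = (t1 + k, v1)"
    unfolding bounce_tv_def by (rule the1_equality[rotated])
  moreover have "to_circle (t1 + k) = to_circle t1"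
    using k by (simp add: to_circle_eq_iff)
  ultimately show ?thesis
    using v0 by (simp add: bounce_map_def r_def)
qed

end

theory Submission
  imports Defs
begin

text \<open>Impact times \<open>t n = x n + k n\<close> with \<open>k n\<close> an integer form an orbit iff the velocity after
  each impact, computed from the next gap, equals the one computed from the previous gap. At high
  energy this says that the second difference of \<open>t\<close> is \<open>4 / g * f' (x n)\<close> up to a small error.
  Choose \<open>a < b < a + 1\<close> with \<open>f' a \<le> - g / 2\<close> and \<open>f' b \<ge> g / 2\<close>, and prescribe the increments of
  \<open>k\<close> to be \<open>N\<close> or \<open>N + 1\<close> arbitrarily, so that the second difference of \<open>k\<close> is at most 1 in
  absolute value, whereas \<open>4 / g * f'\<close> is at most -2 at \<open>a\<close> and at least 2 at \<open>b\<close>. Then a minimiser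
  of the action over all \<open>x\<close> with values in \<open>[a, b]\<close> cannot touch the boundary and is an orbit;
  finite windows of impacts and compactness give bi-infinite orbits. The point of phase space
  determines the whole orbit, hence the increments of \<open>k\<close>, so the set of all these
  orbits is semi-conjugate to the full shift already under one iterate, and
  the same set serves for every index.\<close>

section \<open>Topology of the sequence spaces and of the circle\<close>

lemma compact_box:
  fixes a b :: real
  shows "compact {x :: 'i \<Rightarrow> real. \<forall>n. x n \<in> {a..b}}"
proof -
  have "compactin (product_topology (\<lambda>_. euclidean) UNIV) (PiE UNIV (\<lambda>_::'i. {a..b}))"
    by (subst compactin_PiE) auto
  then show ?thesis
    by (simp add: euclidean_product_topology PiE_UNIV_domain Pi_def)
qed

lemma compact_UNIV_fun_bool: "compact (UNIV :: ('i \<Rightarrow> bool) set)"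
proof -
  have "compactin (product_topology (\<lambda>_. euclidean) UNIV) (PiE UNIV (\<lambda>_::'i. UNIV :: bool set))"
    by (subst compactin_PiE) (auto simp: finite_imp_compact)
  then show ?thesis
    by (simp add: euclidean_product_topology PiE_UNIV_domain)
qed

text \<open>The map \<open>t \<mapsto> cis (2 * pi * t)\<close> descends to a continuous injection
  of the circle into the complex plane, along which separating neighbourhoods pull back. The
  Hausdorff property later makes the inverse of \<open>state\<close> continuous.\<close>

instance circle :: t2_space
proof
  define c where "c x = cis (2 * pi * rep_circle x)" for x
  have c: "c (to_circle t) = cis (2 * pi * t)" for t
  proof -
    have "rep_circle (to_circle t) - t \<in> \<int>"
      by (metis to_circle_eq_iff to_circle_rep)
    then obtain k where "rep_circle (to_circle t) = t + of_int k"
      by (metis Ints_cases add.commute diff_add_cancel)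
    then show ?thesis
      by (simp add: c_def distrib_left cis_mult[symmetric] cis_multiple_2pi)
  qed
  have inj: "x = y" if "c x = c y" for x y
  proof -
    have "cis (2 * pi * (rep_circle x - rep_circle y)) = 1"
      using that by (simp add: c_def right_diff_distrib cis_divide[symmetric])
    then have "cos (2 * pi * (rep_circle x - rep_circle y)) = 1"
      by (metis cis.sel(1) one_complex.sel(1))
    then obtain n where "2 * pi * (rep_circle x - rep_circle y) = of_int n * 2 * pi"
      by (auto simp: cos_one_2pi_int)
    then have "rep_circle x - rep_circle y = of_int n"
      by simp
    then show "x = y"
      by (metis Ints_of_int to_circle_eq_iff to_circle_rep)
  qed
  have op: "open (c -` U)" if "open U" for U
  proof -
    have "to_circle -` (c -` U) = (\<lambda>t. cis (2 * pi * t)) -` U"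
      by (auto simp: c)
    moreover have "open ((\<lambda>t. cis (2 * pi * t)) -` U)"
      using that by (intro open_vimage continuous_intros)
    ultimately show ?thesis by (simp add: open_circle_def)
  qed
  fix x y :: circle
  assume "x \<noteq> y"
  then obtain U V where "open U" "open V" "c x \<in> U" "c y \<in> V" "U \<inter> V = {}"
    using inj hausdorff[of "c x" "c y"] by blast
  then show "\<exists>U V. open U \<and> open V \<and> x \<in> U \<and> y \<in> V \<and> U \<inter> V = {}"
    using op[of U] op[of V] by (intro exI[of _ "c -` U"] exI[of _ "c -` V"]) auto
qed

section \<open>Auxiliary facts on real functions\<close>

text \<open>With \<open>\<phi> d = f (t \<plusminus> d) - f t\<close> this says that two consecutive impact times \<open>t\<close> and
  \<open>t \<plusminus> d\<close> are determined by one of them and the velocity there.\<close>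

lemma gap_determined:
  fixes \<phi> :: "real \<Rightarrow> real"
  assumes g: "g > 0" and "M \<ge> 0" and lip: "\<And>s t. \<bar>\<phi> s - \<phi> t\<bar> \<le> M * \<bar>s - t\<bar>" and "\<phi> 0 = 0"
    and d: "d > 4 * M / g" and d': "d' > 4 * M / g"
    and eq: "g / 2 * d + \<phi> d / d = g / 2 * d' + \<phi> d' / d'"
  shows "d = d'"
proof (rule ccontr)
  assume "d \<noteq> d'"
  have pos: "d > 0" "d' > 0"
    using d d' g \<open>M \<ge> 0\<close> by (meson divide_nonneg_pos le_less_trans mult_nonneg_nonneg zero_le_numeral)+
  \<comment> \<open>Denominators cleared. Each summand on the right is at most
    \<open>M * d' * \<bar>d - d'\<bar>\<close> in absolute value, which forces
    \<open>g / 2 * d \<le> 2 * M\<close>, against the lower bound on \<open>d\<close>.\<close>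
  have "g / 2 * (d - d') * (d * d') = (\<phi> d' - \<phi> d) * d' + \<phi> d' * (d - d')"
    using eq pos by (simp add: field_simps)
  then have "\<bar>g / 2 * (d - d') * (d * d')\<bar> \<le> \<bar>\<phi> d' - \<phi> d\<bar> * d' + \<bar>\<phi> d'\<bar> * \<bar>d - d'\<bar>"
    using pos by (metis abs_mult abs_of_pos abs_triangle_ineq)
  also have "\<dots> \<le> (M * \<bar>d - d'\<bar>) * d' + (M * d') * \<bar>d - d'\<bar>"
    using lip[of d' d] lip[of d' 0] \<open>\<phi> 0 = 0\<close> pos
    by (intro add_mono mult_right_mono) (auto simp: abs_minus_commute)
  also have "\<bar>g / 2 * (d - d') * (d * d')\<bar> = (g / 2 * d) * (d' * \<bar>d - d'\<bar>)"
    using g pos by (simp add: abs_mult)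
  finally have "(g / 2 * d) * (d' * \<bar>d - d'\<bar>) \<le> (2 * M) * (d' * \<bar>d - d'\<bar>)"
    by (simp add: algebra_simps)
  then have "g / 2 * d \<le> 2 * M"
    by (rule mult_right_le_imp_le) (use pos \<open>d \<noteq> d'\<close> in auto)
  then show False
    using d g by (simp add: field_simps)
qed

text \<open>At an end point the prescribed sign of the derivative would make \<open>\<psi>\<close>
  smaller just inside the interval. So the minimum is interior and Fermat's criterion
  applies.\<close>

lemma interior_critical_min:
  fixes \<psi> :: "real \<Rightarrow> real"
  assumes y: "y \<in> {a..b}" and min: "\<And>s. s \<in> {a..b} \<Longrightarrow> \<psi> y \<le> \<psi> s"
    and D: "(\<psi> has_real_derivative D) (at y)" and "a < b"
    and "y = a \<Longrightarrow> D < 0" and "y = b \<Longrightarrow> D > 0"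
  shows "D = 0"
proof -
  consider "y = a" | "y = b" | "a < y" "y < b" using y by force
  then show ?thesis
  proof cases
    case 1
    obtain d where "d > 0" "\<forall>h>0. h < d \<longrightarrow> \<psi> (y + h) < \<psi> y"
      using DERIV_neg_dec_right[OF D] assms(5) 1 by blast
    moreover obtain h where "h > 0" "h < d" "h < b - a"
      using \<open>d > 0\<close> \<open>a < b\<close> by (metis diff_gt_0_iff_gt field_lbound_gt_zero)
    ultimately show ?thesis using min[of "y + h"] 1 by force
  next
    case 2
    obtain d where "d > 0" "\<forall>h>0. h < d \<longrightarrow> \<psi> (y - h) < \<psi> y"
      using DERIV_pos_inc_left[OF D] assms(6) 2 by blast
    moreover obtain h where "h > 0" "h < d" "h < b - a"
      using \<open>d > 0\<close> \<open>a < b\<close> by (metis diff_gt_0_iff_gt field_lbound_gt_zero)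
    ultimately show ?thesis using min[of "y - h"] 2 by force
  next
    case 3
    have "\<forall>s. \<bar>y - s\<bar> < min (y - a) (b - y) \<longrightarrow> \<psi> y \<le> \<psi> s"
      by (intro allI impI min) auto
    then show ?thesis
      using DERIV_local_min[OF D, of "min (y - a) (b - y)"] 3 by simp
  qed
qed

lemma ex_int_translate:
  fixes a c :: real
  obtains k where "k \<in> \<int>" "a \<le> c + k" "c + k < a + 1"
proof
  show "a \<le> c + of_int \<lceil>a - c\<rceil>" "c + of_int \<lceil>a - c\<rceil> < a + 1" by linarith+
qed simp

text \<open>By periodicity both extrema of \<open>deriv f\<close> are attained on
  \<open>{0..1}\<close>. A translate of the maximum point lies in \<open>{a..<a + 1}\<close>, and it
  is not \<open>a\<close> because \<open>deriv f\<close> has opposite signs at the two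
  points.\<close>

lemma deriv_extremal_points:
  fixes f :: "real \<Rightarrow> real"
  assumes "C2 f" and per: "\<And>t. f (t + 1) = f t" and "r > 0"
    and sup: "(SUP t. deriv f t) \<ge> r" and inf: "(INF t. deriv f t) \<le> - r"
  obtains a b where "a < b" "b < a + 1" "deriv f a \<le> - r" "deriv f b \<ge> r"
proof -
  have cont: "continuous_on {0..1} (deriv f)"
    using assms(1) unfolding C2_def
    by (meson continuous_at_imp_continuous_on differentiable_imp_continuous_within)
  have red: "\<exists>s\<in>{0..1}. deriv f s = deriv f t" for t
  proof -
    obtain k where "k \<in> \<int>" "0 \<le> t + k" "t + k < 0 + 1"
      by (rule ex_int_translate)
    then show ?thesis
      using deriv_periodic_int[of f, OF per, of k t] by (intro bexI[of _ "t + k"]) auto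
  qed
  obtain a where a: "\<forall>t\<in>{0..1}. deriv f a \<le> deriv f t"
    using continuous_attains_inf[OF _ _ cont] by auto
  have "deriv f a \<le> (INF t. deriv f t)"
    by (rule cINF_greatest) (use red a in \<open>auto, metis\<close>)
  moreover
  obtain b where b: "\<forall>t\<in>{0..1}. deriv f t \<le> deriv f b"
    using continuous_attains_sup[OF _ _ cont] by auto
  have "(SUP t. deriv f t) \<le> deriv f b"
    by (rule cSUP_least) (use red b in \<open>auto, metis\<close>)
  moreover obtain k where k: "k \<in> \<int>" "a \<le> b + k" "b + k < a + 1"
    by (rule ex_int_translate)
  moreover have "deriv f (b + k) = deriv f b"
    using deriv_periodic_int[of f, OF per] k by simp
  moreover have "a \<noteq> b + k"
    using calculation \<open>r > 0\<close> sup inf by force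
  ultimately show thesis
    using that[of a "b + k"] sup inf by simp
qed

section \<open>Symbol sequences, velocities and the action\<close>

text \<open>The bound on \<open>N\<close> is made for \<open>gap_large\<close>: positions in
  \<open>{a..b}\<close> differ by less than 1, so successive impacts lie more than
  \<open>4 * M / g\<close> apart, the threshold of \<open>gap_determined\<close>.\<close>

locale bouncing_ball =
  fixes g M a b :: real and f :: "real \<Rightarrow> real" and N :: nat
  assumes g: "g > 0"
    and f: "C2 f"
    and per: "f (t + 1) = f t"
    and M: "\<bar>deriv f t\<bar> \<le> M"
    and ab: "a < b" "b < a + 1"
    and deriv_a: "deriv f a \<le> - (g / 2)"
    and deriv_b: "deriv f b \<ge> g / 2"
    and N: "real N > 4 * M / g + 1"
begin

text \<open>The time between impacts \<open>n\<close> and \<open>n + 1\<close>. Only the increments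
  \<open>N + of_bool (e n)\<close> of the integer parts enter, so the integer parts themselves are
  never built.\<close>

definition gap :: "(int \<Rightarrow> real) \<Rightarrow> (int \<Rightarrow> bool) \<Rightarrow> int \<Rightarrow> real" where
  "gap x e n = real N + of_bool (e n) + x (n + 1) - x n"

text \<open>The divided difference of \<open>f\<close> between the two impact times; by periodicity
  their integer parts drop out of the numerator.\<close>

definition slope :: "(int \<Rightarrow> real) \<Rightarrow> (int \<Rightarrow> bool) \<Rightarrow> int \<Rightarrow> real" where
  "slope x e n = (f (x (n + 1)) - f (x n)) / gap x e n"

text \<open>\<open>v_out\<close> is the first impact equation solved for the initial velocity;
  inserting it into the second equation gives \<open>v_in\<close> at the next impact.\<close>

definition v_out :: "(int \<Rightarrow> real) \<Rightarrow> (int \<Rightarrow> bool) \<Rightarrow> int \<Rightarrow> real" where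
  "v_out x e n = g / 2 * gap x e n + slope x e n - deriv f (x n)"

definition v_in :: "(int \<Rightarrow> real) \<Rightarrow> (int \<Rightarrow> bool) \<Rightarrow> int \<Rightarrow> real" where
  "v_in x e n = g / 2 * gap x e (n - 1) - slope x e (n - 1) + deriv f (x n)"

definition box :: "(int \<Rightarrow> real) set" where
  "box = {x. \<forall>n. x n \<in> {a..b}}"

text \<open>Written as an intersection of closed sets indexed by the impacts, the form to which
  compactness and the finite intersection property apply; \<open>orbits_iff\<close> unfolds
  it.\<close>

definition orbits :: "((int \<Rightarrow> real) \<times> (int \<Rightarrow> bool)) set" where
  "orbits = (box \<times> UNIV) \<inter> (\<Inter>n. {p \<in> box \<times> UNIV. v_out (fst p) (snd p) n = v_in (fst p) (snd p) n})"

text \<open>Generating function of the map: its partial derivatives are \<open>- v\<^sup>2 / 2\<close> after the first impact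
  and \<open>v\<^sup>2 / 2\<close> after the second one, up to functions of a single impact time which cancel when
  consecutive actions are added.\<close>

definition action :: "real \<Rightarrow> real \<Rightarrow> real \<Rightarrow> real" where
  "action c y z = g\<^sup>2 * (c + z - y) ^ 3 / 24 + g / 2 * (c + z - y) * (f y + f z)
     - (f z - f y)\<^sup>2 / (2 * (c + z - y))"

section \<open>Estimates and the derivative of the action\<close>

lemma f_DERIV: "(f has_real_derivative deriv f t) (at t)"
  using f by (simp add: C2_def DERIV_deriv_iff_real_differentiable)

lemma continuous_f: "continuous_on UNIV f" and continuous_deriv_f: "continuous_on UNIV (deriv f)"
  using f unfolding C2_def
  by (meson continuous_at_imp_continuous_on differentiable_imp_continuous_within)+

lemma M_nonneg: "M \<ge> 0"
  using M[of 0] by linarith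

lemma f_lipschitz: "\<bar>f s - f t\<bar> \<le> M * \<bar>s - t\<bar>"
  using field_differentiable_bound[of UNIV f "deriv f" M s t] f_DERIV M by auto

lemma mem_boxD: "x \<in> box \<Longrightarrow> a \<le> x n" "x \<in> box \<Longrightarrow> x n \<le> b"
  by (auto simp: box_def)

lemma gap_lower: "x \<in> box \<Longrightarrow> gap x e n > real N - 1"
  using mem_boxD[of x n] mem_boxD[of x "n + 1"] ab by (simp add: gap_def)

lemma gap_large: "x \<in> box \<Longrightarrow> gap x e n > 4 * M / g"
  using gap_lower[of x e n] N by linarith

lemma gap_pos: "x \<in> box \<Longrightarrow> gap x e n > 0"
  using gap_large[of x e n] M_nonneg g
  by (meson divide_nonneg_pos le_less_trans mult_nonneg_nonneg zero_le_numeral)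

text \<open>The numerator is at most \<open>M\<close> because the positions differ by less than 1,
  and the gap exceeds \<open>4 * M / g\<close>. The value \<open>g / 4\<close> is what
  \<open>v_jump\<close> can afford for each of two slopes.\<close>

lemma slope_small:
  assumes "x \<in> box"
  shows "\<bar>slope x e n\<bar> < g / 4"
proof -
  note pos = gap_pos[OF assms, of e n]
  have "\<bar>f (x (n + 1)) - f (x n)\<bar> \<le> M * \<bar>x (n + 1) - x n\<bar>"
    by (rule f_lipschitz)
  also have "\<dots> \<le> M * 1"
    using mem_boxD[OF assms, of n] mem_boxD[OF assms, of "n + 1"] ab M_nonneg
    by (intro mult_left_mono) auto
  also have "\<dots> < g / 4 * gap x e n"
    using gap_large[OF assms, of e n] g by (simp add: field_simps)
  finally show ?thesis
    using pos by (simp add: slope_def divide_less_eq)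
qed

text \<open>\<open>c + s - y\<close> and \<open>c' + z - s\<close> are the gaps before and after the
  impact at \<open>s\<close>, so the squared terms are the velocities computed from either gap. The
  two actions also contribute \<open>g * f s - (deriv f s)\<^sup>2 / 2\<close> with opposite signs,
  which cancels.\<close>

lemma action_DERIV_sum:
  assumes "c + s - y \<noteq> 0" "c' + z - s \<noteq> 0"
  shows "((\<lambda>s. action c y s + action c' s z) has_real_derivative
     ((g / 2 * (c + s - y) - (f s - f y) / (c + s - y) + deriv f s)\<^sup>2
       - (g / 2 * (c' + z - s) + (f z - f s) / (c' + z - s) - deriv f s)\<^sup>2) / 2) (at s)"
proof -
  have 1: "((\<lambda>s. action c y s) has_real_derivative
     (g / 2 * (c + s - y) - (f s - f y) / (c + s - y) + deriv f s)\<^sup>2 / 2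
      + g * f s - (deriv f s)\<^sup>2 / 2) (at s)"
  proof -
    define d S where "d = c + s - y" and "S = (f s - f y) / d"
    have d: "d \<noteq> 0" and fs: "f s = f y + S * d" using assms(1) by (simp_all add: d_def S_def)
    have dd: "((\<lambda>s. c + s - y) has_real_derivative 1) (at s)"
      by (auto intro!: derivative_eq_intros)
    have "2 * (c + s - y) \<noteq> 0" using assms(1) by simp
    from DERIV_diff[OF DERIV_add[OF DERIV_cdivide[OF DERIV_cmult[OF DERIV_power[OF dd, of 3],
          of "g\<^sup>2"], of 24] DERIV_mult[OF DERIV_cmult[OF dd, of "g / 2"]
          DERIV_add[OF DERIV_const[of "f y"] f_DERIV]]]
        DERIV_divide[OF DERIV_power[OF DERIV_diff[OF f_DERIV DERIV_const[of "f y"]], of 2]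
          DERIV_cmult[OF dd, of 2] this]]
    have "((\<lambda>s. action c y s) has_real_derivative
       g\<^sup>2 * (3 * d\<^sup>2) / 24 + (g / 2 * (f y + f s) + g / 2 * d * deriv f s)
       - (2 * (f s - f y) * deriv f s * (2 * d) - (f s - f y)\<^sup>2 * 2) / (2 * d)\<^sup>2) (at s)"
      unfolding action_def d_def[symmetric]
      by (rule DERIV_cong) (simp add: power2_eq_square algebra_simps)
    \<comment> \<open>Substituting \<open>f s = f y + S * d\<close> removes the denominators; the
      remaining terms then complete to the square of the velocity.\<close>
    moreover have "(2 * (f s - f y) * deriv f s * (2 * d) - (f s - f y)\<^sup>2 * 2) / (2 * d)\<^sup>2
        = S * deriv f s - S\<^sup>2 / 2"
      using d by (simp add: fs field_simps power2_eq_square)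
    ultimately have "((\<lambda>s. action c y s) has_real_derivative
       g\<^sup>2 * (3 * d\<^sup>2) / 24 + (g / 2 * (f y + f s) + g / 2 * d * deriv f s)
       - (S * deriv f s - S\<^sup>2 / 2)) (at s)" by simp
    then show ?thesis
      by (rule DERIV_cong)
        (simp add: d_def[symmetric] S_def[symmetric], simp add: fs field_simps power2_eq_square)
  qed
  have 2: "((\<lambda>s. action c' s z) has_real_derivative
     - ((g / 2 * (c' + z - s) + (f z - f s) / (c' + z - s) - deriv f s)\<^sup>2 / 2)
      - g * f s + (deriv f s)\<^sup>2 / 2) (at s)"
  proof -
    define d S where "d = c' + z - s" and "S = (f z - f s) / d"
    have d: "d \<noteq> 0" and fz: "f z = f s + S * d" using assms(2) by (simp_all add: d_def S_def)
    have dd: "((\<lambda>s. c' + z - s) has_real_derivative - 1) (at s)"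
      by (auto intro!: derivative_eq_intros)
    have "2 * (c' + z - s) \<noteq> 0" using assms(2) by simp
    from DERIV_diff[OF DERIV_add[OF DERIV_cdivide[OF DERIV_cmult[OF DERIV_power[OF dd, of 3],
          of "g\<^sup>2"], of 24] DERIV_mult[OF DERIV_cmult[OF dd, of "g / 2"]
          DERIV_add[OF f_DERIV DERIV_const[of "f z"]]]]
        DERIV_divide[OF DERIV_power[OF DERIV_diff[OF DERIV_const[of "f z"] f_DERIV], of 2]
          DERIV_cmult[OF dd, of 2] this]]
    have "((\<lambda>s. action c' s z) has_real_derivative
       - (g\<^sup>2 * (3 * d\<^sup>2) / 24) + (- (g / 2 * (f s + f z)) + g / 2 * d * deriv f s)
       - (- (2 * (f z - f s) * deriv f s * (2 * d)) + (f z - f s)\<^sup>2 * 2) / (2 * d)\<^sup>2) (at s)"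
      unfolding action_def d_def[symmetric]
      by (rule DERIV_cong) (simp add: power2_eq_square algebra_simps)
    moreover have "(- (2 * (f z - f s) * deriv f s * (2 * d)) + (f z - f s)\<^sup>2 * 2) / (2 * d)\<^sup>2
        = - S * deriv f s + S\<^sup>2 / 2"
      using d by (simp add: fz field_simps power2_eq_square)
    ultimately have "((\<lambda>s. action c' s z) has_real_derivative
       - (g\<^sup>2 * (3 * d\<^sup>2) / 24) + (- (g / 2 * (f s + f z)) + g / 2 * d * deriv f s)
       - (- S * deriv f s + S\<^sup>2 / 2)) (at s)" by simp
    then show ?thesis
      by (rule DERIV_cong)
        (simp add: d_def[symmetric] S_def[symmetric], simp add: fz field_simps power2_eq_square)
  qed
  show ?thesis
    by (rule DERIV_cong[OF DERIV_add[OF 1 2]]) (simp add: field_simps)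
qed

text \<open>At \<open>a\<close> the neighbouring positions contribute nonnegatively and the symbols
  at least -1, so the bracket costs at most \<open>g / 2\<close>. The two slopes cost strictly less
  than \<open>g / 2\<close> together, and \<open>- 2 * deriv f a\<close> gains at least
  \<open>g\<close>. The case of \<open>b\<close> is the mirror image.\<close>

lemma v_jump:
  assumes "x \<in> box"
  shows "x n = a \<Longrightarrow> v_in x e n < v_out x e n" and "x n = b \<Longrightarrow> v_out x e n < v_in x e n"
proof -
  note bounds = slope_small[OF assms, of e n] slope_small[OF assms, of e "n - 1"]
    mem_boxD[OF assms, of "n + 1"] mem_boxD[OF assms, of "n - 1"]
  have *: "v_out x e n - v_in x e n = g / 2 * (of_bool (e n) - of_bool (e (n - 1))
      + (x (n + 1) + x (n - 1) - 2 * x n)) + slope x e n + slope x e (n - 1) - 2 * deriv f (x n)"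
    by (simp add: v_out_def v_in_def gap_def algebra_simps)
  show "v_in x e n < v_out x e n" if "x n = a"
  proof -
    have "g / 2 * (of_bool (e n) - of_bool (e (n - 1)) + (x (n + 1) + x (n - 1) - 2 * x n)) \<ge> g / 2 * (-1)"
      using that bounds g by (intro mult_left_mono) (auto simp: of_bool_def)
    then show ?thesis using * bounds deriv_a that by auto
  qed
  show "v_out x e n < v_in x e n" if "x n = b"
  proof -
    have "g / 2 * (of_bool (e n) - of_bool (e (n - 1)) + (x (n + 1) + x (n - 1) - 2 * x n)) \<le> g / 2 * 1"
      using that bounds g by (intro mult_left_mono) (auto simp: of_bool_def)
    then show ?thesis using * bounds deriv_b that by auto
  qed
qed

text \<open>The bound grows with \<open>N\<close>; it yields both the positivity of the velocities
  and energies above \<open>Ebar\<close>.\<close>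

lemma v_lower:
  assumes "x \<in> box"
  shows "v_out x e n > g / 2 * (real N - 1) - g / 4 - M"
    and "v_in x e n > g / 2 * (real N - 1) - g / 4 - M"
proof -
  have "g / 2 * gap x e k > g / 2 * (real N - 1)" for k
    using gap_lower[OF assms, of e k] g by (intro mult_strict_left_mono) auto
  from this[of n] this[of "n - 1"]
  show "v_out x e n > g / 2 * (real N - 1) - g / 4 - M"
    and "v_in x e n > g / 2 * (real N - 1) - g / 4 - M"
    using slope_small[OF assms, of e n] slope_small[OF assms, of e "n - 1"] M[of "x n"]
    unfolding v_out_def v_in_def by linarith+
qed

lemma v_pos:
  assumes "x \<in> box"
  shows "v_out x e n > 0" and "v_in x e n > 0"
proof -
  have "g / 2 * (real N - 1) > g / 2 * (4 * M / g)"
    using N g by (intro mult_strict_left_mono) auto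
  \<comment> \<open>With this, \<open>2 * M\<close> exceeds the loss \<open>g / 4 + M\<close> in
    \<open>v_lower\<close>.\<close>
  moreover have "M \<ge> g / 2"
    using M[of b] deriv_b by linarith
  ultimately show "v_out x e n > 0" and "v_in x e n > 0"
    using v_lower[OF assms, of e n] g by auto
qed

section \<open>Compactness of the set of orbits\<close>

lemma continuous_on_proj [continuous_intros]:
  "continuous_on B (\<lambda>p :: (int \<Rightarrow> real) \<times> 'b :: topological_space. fst p n)"
  "continuous_on A (\<lambda>p :: (int \<Rightarrow> real) \<times> (int \<Rightarrow> bool). of_bool (snd p n) :: real)"
proof -
  show "continuous_on B (\<lambda>p :: (int \<Rightarrow> real) \<times> 'b :: topological_space. fst p n)"
    by (rule continuous_on_product_then_coordinatewise) (rule continuous_on_fst[OF continuous_on_id])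
  have "continuous_on A (\<lambda>p :: (int \<Rightarrow> real) \<times> (int \<Rightarrow> bool). snd p n)"
    by (rule continuous_on_product_then_coordinatewise) (rule continuous_on_snd[OF continuous_on_id])
  then show "continuous_on A (\<lambda>p :: (int \<Rightarrow> real) \<times> (int \<Rightarrow> bool). of_bool (snd p n) :: real)"
    using continuous_on_compose2
      [OF Topological_Spaces.continuous_on_discrete[of UNIV "of_bool :: bool \<Rightarrow> real"]]
    by blast
qed

lemma continuous_on_v:
  "continuous_on (box \<times> UNIV) (\<lambda>p. v_out (fst p) (snd p) n)"
  "continuous_on (box \<times> UNIV) (\<lambda>p. v_in (fst p) (snd p) n)"
proof -
  have F: "continuous_on (box \<times> UNIV) (\<lambda>p. f (fst p n))" for n
    by (rule continuous_on_compose2[OF continuous_f]) (auto simp: continuous_on_proj)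
  have F': "continuous_on (box \<times> UNIV) (\<lambda>p. deriv f (fst p n))" for n
    by (rule continuous_on_compose2[OF continuous_deriv_f]) (auto simp: continuous_on_proj)
  have G: "continuous_on (box \<times> UNIV) (\<lambda>p. gap (fst p) (snd p) n)" for n
    unfolding gap_def by (intro continuous_intros)
  have S: "continuous_on (box \<times> UNIV) (\<lambda>p. slope (fst p) (snd p) n)" for n
    unfolding slope_def
    by (intro continuous_intros F G ballI) (metis gap_pos less_irrefl mem_Times_iff)
  show "continuous_on (box \<times> UNIV) (\<lambda>p. v_out (fst p) (snd p) n)"
    "continuous_on (box \<times> UNIV) (\<lambda>p. v_in (fst p) (snd p) n)"
    unfolding v_out_def v_in_def by (intro continuous_intros F F' G S)+
qed

lemma compact_boxes: "compact box" "compact (box \<times> (UNIV :: (int \<Rightarrow> bool) set))"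
  unfolding box_def by (intro compact_Times compact_box compact_UNIV_fun_bool)+

lemma closed_boxes: "closed (box \<times> (UNIV :: (int \<Rightarrow> bool) set))"
proof -
  have "closed box"
    unfolding box_def atLeastAtMost_iff
    by (intro closed_Collect_all closed_Collect_conj closed_Collect_le continuous_on_const
        continuous_on_product_coordinates)
  then show ?thesis by (intro closed_Times) auto
qed

lemma closed_balanced: "closed {p \<in> box \<times> UNIV. v_out (fst p) (snd p) n = v_in (fst p) (snd p) n}"
proof -
  have "continuous_on (box \<times> UNIV) (\<lambda>p. v_out (fst p) (snd p) n - v_in (fst p) (snd p) n)"
    by (intro continuous_on_diff continuous_on_v)
  from continuous_closed_preimage_constant[OF this closed_boxes, of 0] show ?thesis by simp
qed

lemma compact_orbits: "compact orbits"
  unfolding orbits_def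
  by (intro compact_Int_closed compact_boxes closed_INT ballI closed_balanced)

section \<open>Existence of orbits with prescribed symbols\<close>

text \<open>A minimiser over \<open>box\<close> of a finite sum of actions is critical in each
  coordinate of the window, since \<open>v_jump\<close> keeps these coordinates off the
  boundary.\<close>

lemma finite_window_critical:
  assumes "finite I"
  obtains x where "x \<in> box" "\<forall>n\<in>I. v_out x e n = v_in x e n"
proof -
  define c where "c n = real N + of_bool (e n)" for n
  \<comment> \<open>The coordinate \<open>x n\<close> occurs exactly in the actions with index
    \<open>n - 1\<close> and \<open>n\<close>, so both must be in the sum for every \<open>n\<close>
    in the window.\<close>
  define J where "J = I \<union> (\<lambda>n. n - 1) ` I"
  define W where "W x = (\<Sum>n\<in>J. action (c n) (x n) (x (n + 1)))" for x
  have gap_c: "c n + x (n + 1) - x n = gap x e n" for x n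
    by (simp add: c_def gap_def)
  have "continuous_on box W"
  proof -
    have X: "continuous_on box (\<lambda>x. x n)" for n :: int
      by (rule continuous_on_product_then_coordinatewise[OF continuous_on_id])
    have F: "continuous_on box (\<lambda>x. f (x n))" for n
      by (rule continuous_on_compose2[OF continuous_f X]) auto
    have nz: "\<forall>x\<in>box. 2 * (c n + x (n + 1) - x n) \<noteq> 0" for n
      using gap_pos[of _ e n] by (force simp: gap_c)
    show ?thesis
      unfolding W_def action_def by (intro continuous_intros X F nz) auto
  qed
  moreover have "box \<noteq> {}"
    using ab by (auto simp: box_def intro!: exI[of _ "\<lambda>_. a"])
  ultimately obtain x where x: "x \<in> box" and min: "\<And>y. y \<in> box \<Longrightarrow> W x \<le> W y"
    using continuous_attains_inf[of box W] compact_boxes by blast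
  have "v_out x e n = v_in x e n" if "n \<in> I" for n
  proof -
    define \<psi> where "\<psi> s = action (c (n - 1)) (x (n - 1)) s + action (c n) s (x (n + 1))" for s
    define R where "R = (\<Sum>k\<in>J - {n - 1, n}. action (c k) (x k) (x (k + 1)))"
    have J: "finite J" "{n - 1, n} \<subseteq> J"
      using \<open>n \<in> I\<close> \<open>finite I\<close> by (auto simp: J_def)
    have W: "W (x(n := s)) = R + \<psi> s" for s
    proof -
      have "W (x(n := s)) =
          (\<Sum>k\<in>J - {n - 1, n}. action (c k) ((x(n := s)) k) ((x(n := s)) (k + 1))) +
          (\<Sum>k\<in>{n - 1, n}. action (c k) ((x(n := s)) k) ((x(n := s)) (k + 1)))"
        unfolding W_def by (rule sum.subset_diff) (use J in auto)
      also have "(\<Sum>k\<in>J - {n - 1, n}. action (c k) ((x(n := s)) k) ((x(n := s)) (k + 1))) = R"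
        unfolding R_def by (rule sum.cong) auto
      finally show ?thesis by (simp add: \<psi>_def fun_upd_def)
    qed
    have "\<psi> (x n) \<le> \<psi> s" if "s \<in> {a..b}" for s
    proof -
      have "x(n := s) \<in> box" using x that by (auto simp: box_def)
      from min[OF this] show ?thesis using W[of s] W[of "x n"] by simp
    qed
    moreover have "(\<psi> has_real_derivative ((v_in x e n)\<^sup>2 - (v_out x e n)\<^sup>2) / 2) (at (x n))"
    proof -
      have g1: "c (n - 1) + x n - x (n - 1) = gap x e (n - 1)" using gap_c[of "n - 1" x] by simp
      show ?thesis
        using action_DERIV_sum[of "c (n - 1)" "x n" "x (n - 1)" "c n" "x (n + 1)"]
          gap_pos[OF x, of e n] gap_pos[OF x, of e "n - 1"]
        unfolding \<psi>_def[abs_def] gap_c g1 by (simp add: v_out_def v_in_def slope_def)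
    qed
    \<comment> \<open>Positivity of the velocities turns the inequalities of \<open>v_jump\<close>
      into the required signs of this difference of squares, and afterwards equal squares into equal
      velocities.\<close>
    ultimately have "((v_in x e n)\<^sup>2 - (v_out x e n)\<^sup>2) / 2 = 0"
      using v_jump[OF x, of n e] v_pos[OF x, of e n] mem_boxD[OF x, of n] ab
      by (intro interior_critical_min[of "x n" a b \<psi>]) (auto simp: power_strict_mono)
    then show ?thesis
      using v_pos[OF x, of e n] by (simp add: power2_eq_iff_nonneg)
  qed
  with x show thesis using that by blast
qed

text \<open>For fixed \<open>e\<close>, any finitely many balance conditions can be met in the
  compact set \<open>box \<times> {e}\<close>, hence all of them can be met at once.\<close>

lemma orbit_exists:
  obtains x where "(x, e) \<in> orbits"
proof -
  have "(box \<times> {e}) \<inter> (\<Inter>n. {p \<in> box \<times> UNIV. v_out (fst p) (snd p) n = v_in (fst p) (snd p) n}) \<noteq> {}"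
  proof (rule compact_imp_fip_image)
    show "compact (box \<times> {e})" by (intro compact_Times compact_boxes) auto
  next
    fix I :: "int set" assume "finite I"
    then obtain x where "x \<in> box" "\<forall>n\<in>I. v_out x e n = v_in x e n"
      by (rule finite_window_critical[where e = e])
    then have "(x, e) \<in> (box \<times> {e}) \<inter>
        (\<Inter>n\<in>I. {p \<in> box \<times> UNIV. v_out (fst p) (snd p) n = v_in (fst p) (snd p) n})"
      by auto
    then show "(box \<times> {e}) \<inter>
        (\<Inter>n\<in>I. {p \<in> box \<times> UNIV. v_out (fst p) (snd p) n = v_in (fst p) (snd p) n}) \<noteq> {}"
      by blast
  qed (rule closed_balanced)
  then obtain p where "p \<in> (box \<times> {e}) \<inter>
      (\<Inter>n. {p \<in> box \<times> UNIV. v_out (fst p) (snd p) n = v_in (fst p) (snd p) n})"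
    by blast
  then have "(fst p, e) \<in> orbits" by (auto simp: orbits_def)
  then show thesis by (rule that)
qed

lemma orbits_iff: "(x, e) \<in> orbits \<longleftrightarrow> x \<in> box \<and> (\<forall>n. v_out x e n = v_in x e n)"
  by (auto simp: orbits_def)

section \<open>Orbits as points of phase space\<close>

definition state :: "(int \<Rightarrow> real) \<times> (int \<Rightarrow> bool) \<Rightarrow> circle \<times> real" where
  "state p = (to_circle (fst p 0), (v_out (fst p) (snd p) 0)\<^sup>2 / 2)"

lemma orbits_shift:
  assumes "(x, e) \<in> orbits"
  shows "(\<lambda>n. x (n + 1), bernoulli_shift e) \<in> orbits"
proof -
  let ?x = "\<lambda>n. x (n + 1)" and ?e = "bernoulli_shift e"
  have gap: "gap ?x ?e n = gap x e (n + 1)" for n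
    by (simp add: gap_def bernoulli_shift_def)
  have "v_out ?x ?e n = v_out x e (n + 1)" "v_in ?x ?e n = v_in x e (n + 1)" for n
    by (simp_all add: gap v_out_def v_in_def slope_def)
  then show ?thesis
    using assms by (auto simp: orbits_iff box_def)
qed

text \<open>Expresses the value of \<open>f\<close> at one end of a gap through the other end and
  the gap alone, as \<open>gap_determined\<close> requires.\<close>

lemma periodic_lift:
  shows "f (x (n + 1)) = f (x n + gap x e n)" "f (x n) = f (x (n + 1) - gap x e n)"
proof -
  have *: "real N + of_bool (e n) \<in> \<int>" by (auto simp: of_bool_def)
  have "x n + gap x e n = x (n + 1) + (real N + of_bool (e n))"
    "x (n + 1) - gap x e n = x n + - (real N + of_bool (e n))"
    by (simp_all add: gap_def)
  then show "f (x (n + 1)) = f (x n + gap x e n)" "f (x n) = f (x (n + 1) - gap x e n)"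
    using periodic_int[of f, OF per *] periodic_int[of f, OF per Ints_minus[OF *]] by metis+
qed

text \<open>Once one end is known, the gap fixes the other end up to the symbol, a shift by 0 or 1.
  As \<open>{a..b}\<close> is shorter than 1, only one symbol is possible.\<close>

lemma symbol_determined:
  assumes x: "x \<in> box" and y: "y \<in> box" and "gap x e n = gap y e' n"
    and "x n = y n \<or> x (n + 1) = y (n + 1)"
  shows "x n = y n" "x (n + 1) = y (n + 1)" "e n = e' n"
proof -
  note bounds = mem_boxD[OF x, of n] mem_boxD[OF x, of "n + 1"] mem_boxD[OF y, of n]
    mem_boxD[OF y, of "n + 1"] ab
  show "x n = y n" "x (n + 1) = y (n + 1)" "e n = e' n"
    using assms(3,4) bounds by (cases "e n"; cases "e' n"; auto simp: gap_def)+
qed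

text \<open>Position and outgoing velocity fix the next gap, hence the symbol and the next position;
  then \<open>v_in\<close> at the next impact is known and equals \<open>v_out\<close>
  there.\<close>

lemma orbit_step_determined:
  assumes x: "(x, e) \<in> orbits" and y: "(y, e') \<in> orbits"
    and "x n = y n" "v_out x e n = v_out y e' n"
  shows "x (n + 1) = y (n + 1)" "v_out x e (n + 1) = v_out y e' (n + 1)" "e n = e' n"
proof -
  have box: "x \<in> box" "y \<in> box" using x y by (auto simp: orbits_iff)
  have "gap x e n = gap y e' n"
  proof (rule gap_determined[where \<phi> = "\<lambda>d. f (x n + d) - f (x n)"])
    show "\<bar>(f (x n + s) - f (x n)) - (f (x n + t) - f (x n))\<bar> \<le> M * \<bar>s - t\<bar>" for s t
      using f_lipschitz[of "x n + s" "x n + t"] by simp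
    show "g / 2 * gap x e n + (f (x n + gap x e n) - f (x n)) / gap x e n =
        g / 2 * gap y e' n + (f (x n + gap y e' n) - f (x n)) / gap y e' n"
      using assms(3,4) periodic_lift(1)[of x n e] periodic_lift(1)[of y n e']
      by (simp add: v_out_def slope_def)
  qed (use g M_nonneg gap_large box in auto)
  note gap = this and sym = symbol_determined[OF box this disjI1[OF assms(3)]]
  show "x (n + 1) = y (n + 1)" "e n = e' n" by fact+
  have "v_in x e (n + 1) = v_in y e' (n + 1)"
    using gap sym by (simp add: v_in_def slope_def)
  then show "v_out x e (n + 1) = v_out y e' (n + 1)"
    using x y by (simp add: orbits_iff)
qed

text \<open>The balance condition turns the velocity at \<open>n + 1\<close> into
  \<open>v_in\<close>, which depends on the preceding gap only; that gap is now measured backwards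
  from its right end.\<close>

lemma orbit_step_back_determined:
  assumes x: "(x, e) \<in> orbits" and y: "(y, e') \<in> orbits"
    and "x (n + 1) = y (n + 1)" "v_out x e (n + 1) = v_out y e' (n + 1)"
  shows "x n = y n" "v_out x e n = v_out y e' n"
proof -
  have box: "x \<in> box" "y \<in> box" using x y by (auto simp: orbits_iff)
  have v_in: "v_in x e (n + 1) = v_in y e' (n + 1)"
    using assms by (simp add: orbits_iff)
  let ?t = "x (n + 1)"
  have "gap x e n = gap y e' n"
  proof (rule gap_determined[where \<phi> = "\<lambda>d. f (?t - d) - f ?t"])
    show "\<bar>(f (?t - s) - f ?t) - (f (?t - t) - f ?t)\<bar> \<le> M * \<bar>s - t\<bar>" for s t
      using f_lipschitz[of "?t - s" "?t - t"] by (simp add: abs_minus_commute)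
    have "- slope x e n = (f (?t - gap x e n) - f ?t) / gap x e n"
      "- slope y e' n = (f (?t - gap y e' n) - f ?t) / gap y e' n"
      using assms(3) periodic_lift(2)[of x n e] periodic_lift(2)[of y n e']
      by (simp_all add: slope_def minus_divide_left)
    then show "g / 2 * gap x e n + (f (?t - gap x e n) - f ?t) / gap x e n =
        g / 2 * gap y e' n + (f (?t - gap y e' n) - f ?t) / gap y e' n"
      using v_in assms(3) by (simp add: v_in_def)
  qed (use g M_nonneg gap_large box in auto)
  note gap = this and sym = symbol_determined[OF box this disjI2[OF assms(3)]]
  show "x n = y n" by fact
  show "v_out x e n = v_out y e' n"
    using gap sym by (simp add: v_out_def slope_def)
qed

text \<open>Positions in \<open>{a..b}\<close> that agree modulo 1 are equal, and the energy fixes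
  the positive velocity. Induction in both directions then recovers the whole orbit and its
  symbols.\<close>

lemma inj_on_state: "inj_on state orbits"
proof (rule inj_onI, clarify)
  fix x e y e'
  assume x: "(x, e) \<in> orbits" and y: "(y, e') \<in> orbits" and eq: "state (x, e) = state (y, e')"
  have box: "x \<in> box" "y \<in> box" using x y by (auto simp: orbits_iff)
  have "x 0 - y 0 \<in> \<int>"
    using eq by (simp add: state_def to_circle_eq_iff)
  moreover have "\<bar>x 0 - y 0\<bar> < 1"
    using mem_boxD[OF box(1), of 0] mem_boxD[OF box(2), of 0] ab by auto
  ultimately have "x 0 = y 0"
    using Ints_nonzero_abs_less1[of "x 0 - y 0"] by simp
  moreover have "v_out x e 0 = v_out y e' 0"
    using eq v_pos[OF box(1), of e 0] v_pos[OF box(2), of e' 0]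
    by (simp add: state_def power2_eq_iff_nonneg)
  ultimately have "x n = y n \<and> v_out x e n = v_out y e' n" for n
  proof (induction n rule: int_induct[of _ 0])
    case (step1 i)
    then show ?case using orbit_step_determined[OF x y, of i] by auto
  next
    case (step2 i)
    then show ?case using orbit_step_back_determined[OF x y, of "i - 1"] by auto
  qed auto
  then show "x = y \<and> e = e'"
    using orbit_step_determined(3)[OF x y] by (auto intro!: ext)
qed

lemma continuous_on_state: "continuous_on orbits state"
proof -
  have "continuous_on orbits (\<lambda>p. v_out (fst p) (snd p) 0)"
    by (rule continuous_on_subset[OF continuous_on_v(1)]) (auto simp: orbits_def)
  moreover have "continuous_on orbits (\<lambda>p. to_circle (fst p 0))"
    by (rule continuous_on_compose2[OF continuous_on_to_circle[of UNIV]])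
      (auto intro: continuous_intros)
  ultimately show ?thesis
    unfolding state_def[abs_def] by (intro continuous_intros) auto
qed

text \<open>Lifting the first impact to \<open>x 0\<close>, the next one is \<open>x 1 + k\<close>,
  with \<open>k\<close> the integer part prescribed by the symbol. The impact equations return
  \<open>v_in\<close> there, which the balance condition identifies with the velocity
  \<open>v_out\<close> of the shifted orbit.\<close>

lemma bounce_map_state:
  assumes thr: "bounce_threshold g f Ebar" and E: "snd (state (x, e)) > Ebar"
    and orbit: "(x, e) \<in> orbits"
  shows "bounce_map g f (state (x, e)) = state (\<lambda>n. x (n + 1), bernoulli_shift e)"
proof -
  have box: "x \<in> box" using orbit by (simp add: orbits_iff)
  define k :: real where "k = real N + of_bool (e 0)"
  have k: "k \<in> \<int>" by (auto simp: k_def of_bool_def)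
  have t: "x 1 + k - x 0 = gap x e 0" by (simp add: k_def gap_def)
  have dd: "div_diff f (x 1 + k) (x 0) = slope x e 0"
    using t by (simp add: div_diff_def slope_def periodic_int[of f, OF per k])
  have "x 1 + k \<noteq> x 0"
    using t gap_pos[OF box, of e 0] by linarith
  moreover have "2 / g * v_out x e 0 = gap x e 0 + 2 / g * slope x e 0 - 2 / g * deriv f (x 0)"
    using g by (simp add: v_out_def field_simps)
  then have "x 1 + k = x 0 + 2 / g * v_out x e 0 - 2 / g * slope x e 0 + 2 / g * deriv f (x 0)"
    using t by linarith
  moreover have "v_in x e 1 = v_out x e 0 + deriv f (x 1 + k) - 2 * slope x e 0 + deriv f (x 0)"
    by (simp add: v_out_def v_in_def deriv_periodic_int[of f, OF per k])
  ultimately have "next_impact g f (x 0, v_out x e 0) (x 1 + k, v_in x e 1)"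
    unfolding next_impact_def prod.case dd by blast
  with bounce_map_to_circle[of f g Ebar, OF per thr] v_pos[OF box, of e 0] E
  have "bounce_map g f (state (x, e)) = (to_circle (x 1 + k), (v_in x e 1)\<^sup>2 / 2)"
    by (simp add: state_def)
  also have "to_circle (x 1 + k) = to_circle (x 1)"
    using k by (simp add: to_circle_eq_iff)
  also have "v_in x e 1 = v_out x e 1"
    using orbit by (simp add: orbits_iff)
  also have "v_out x e 1 = v_out (\<lambda>n. x (n + 1)) (bernoulli_shift e) 0"
    by (simp add: v_out_def slope_def gap_def bernoulli_shift_def)
  finally show ?thesis by (simp add: state_def)
qed

section \<open>The invariant set and the semi-conjugacy\<close>

lemma energy_lower:
  assumes "p \<in> orbits" "Ebar \<ge> 0" "g / 2 * (real N - 1) - g / 4 - M \<ge> sqrt (2 * Ebar)"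
  shows "snd (state p) > Ebar"
proof -
  have "fst p \<in> box" using assms(1) by (auto simp: orbits_def)
  then have "sqrt (2 * Ebar) < v_out (fst p) (snd p) 0"
    using v_lower(1)[of "fst p" "snd p" 0] assms(3) by linarith
  then have "(sqrt (2 * Ebar))\<^sup>2 < (v_out (fst p) (snd p) 0)\<^sup>2"
    using assms(2) by (intro power_strict_mono) auto
  then have "2 * Ebar < (v_out (fst p) (snd p) 0)\<^sup>2"
    using assms(2) by simp
  then show ?thesis by (simp add: state_def)
qed

text \<open>\<open>state\<close> is a continuous injection of a compact space into a Hausdorff
  space, so its inverse on the image is continuous. Reading off the symbols after this inverse is
  the semi-conjugacy, and \<open>orbit_exists\<close> makes it surjective.\<close>

lemma semiconj_bernoulli_state:
  assumes thr: "bounce_threshold g f Ebar" and E: "\<And>p. p \<in> orbits \<Longrightarrow> snd (state p) > Ebar"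
  shows "bounce_map g f ` state ` orbits \<subseteq> state ` orbits"
    and "semiconj_bernoulli_on (bounce_map g f) (state ` orbits)"
proof -
  have step: "\<exists>q\<in>orbits. bounce_map g f (state p) = state q \<and> snd q = bernoulli_shift (snd p)"
    if "p \<in> orbits" for p
    using bounce_map_state[OF thr, of "fst p" "snd p"] E[OF that] orbits_shift[of "fst p" "snd p"] that
    by (intro bexI[of _ "(\<lambda>n. fst p (n + 1), bernoulli_shift (snd p))"]) auto
  then show "bounce_map g f ` state ` orbits \<subseteq> state ` orbits" by blast
  let ?h = "the_inv_into orbits state"
  have h: "?h (state p) = p" if "p \<in> orbits" for p
    using that inj_on_state by (rule the_inv_into_f_f[rotated])
  show "semiconj_bernoulli_on (bounce_map g f) (state ` orbits)"
    unfolding semiconj_bernoulli_on_def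
  proof (intro exI[of _ "snd \<circ> ?h"] conjI ballI)
    show "continuous_on (state ` orbits) (snd \<circ> ?h)"
      by (intro continuous_on_compose continuous_on_inv continuous_on_state compact_orbits
          continuous_on_snd continuous_on_id) (simp add: h)
    have "e \<in> (snd \<circ> ?h) ` state ` orbits" for e
    proof -
      obtain x where "(x, e) \<in> orbits" by (rule orbit_exists)
      then show ?thesis by (force simp: image_iff h)
    qed
    then show "(snd \<circ> ?h) ` state ` orbits = UNIV" by blast
  next
    fix z assume "z \<in> state ` orbits"
    then obtain p where "p \<in> orbits" "z = state p" by blast
    with step[of p] show "(snd \<circ> ?h) (bounce_map g f z) = bernoulli_shift ((snd \<circ> ?h) z)"
      by (auto simp: h)
  qed
qed

end

theorem theorem1:
  fixes g Ebar :: real and f :: "real \<Rightarrow> real"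
  assumes "g > 0"
    and "C2 f"
    and "\<And>t. f (t + 1) = f t"
    and "(SUP t. deriv f t) \<ge> g / 2"
    and "(INF t. deriv f t) \<le> - (g / 2)"
    and "bounce_threshold g f Ebar"
  shows "\<exists>(K :: nat \<Rightarrow> (circle \<times> real) set) (Q :: nat \<Rightarrow> nat). \<forall>i.
    compact (K i) \<and> K i \<subseteq> phase_space Ebar \<and> Q i > 0 \<and>
    iterate_leaves_invariant (phase_space Ebar) (bounce_map g f) (Q i) (K i) \<and>
    semiconj_bernoulli_on (bounce_map g f ^^ Q i) (K i)"
proof -
  obtain M where M: "\<And>t. \<bar>deriv f t\<bar> \<le> M"
    using deriv_bounded[OF assms(2,3)] by blast
  have "g / 2 > 0" using assms(1) by simp
  with assms(2-5) obtain a b where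
    ab: "a < b" "b < a + 1" "deriv f a \<le> - (g / 2)" "deriv f b \<ge> g / 2"
    using deriv_extremal_points[of f "g / 2"] by blast
  \<comment> \<open>The first bound is the locale assumption on \<open>N\<close>; the second makes
    the bound of \<open>v_lower\<close> at least \<open>sqrt (2 * Ebar)\<close>, the speed at energy
    \<open>Ebar\<close>.\<close>
  obtain N where "max (4 * M / g + 1) (1 + 2 / g * (sqrt (2 * Ebar) + g / 4 + M)) < real N"
    using reals_Archimedean2 by blast
  then have N_large: "4 * M / g + 1 < real N" "2 / g * (sqrt (2 * Ebar) + g / 4 + M) \<le> real N - 1"
    by auto
  interpret bouncing_ball g M a b f N
    by unfold_locales (use assms M ab N_large in auto)
  have "g / 2 * (2 / g * (sqrt (2 * Ebar) + g / 4 + M)) \<le> g / 2 * (real N - 1)"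
    using N_large(2) assms(1) by (intro mult_left_mono) auto
  then have "g / 2 * (real N - 1) - g / 4 - M \<ge> sqrt (2 * Ebar)"
    using assms(1) by simp
  then have E: "snd (state p) > Ebar" if "p \<in> orbits" for p
    using energy_lower[OF that] assms(6) by (auto simp: bounce_threshold_def)
  note conj = semiconj_bernoulli_state[OF assms(6) E]
  have "compact (state ` orbits)"
    by (intro compact_continuous_image continuous_on_state compact_orbits)
  moreover have "state ` orbits \<subseteq> phase_space Ebar"
    using E by (force simp: phase_space_def mem_Times_iff)
  \<comment> \<open>Both sequences are constant. With \<open>Q i = 1\<close> the iterate is defined
    as soon as the set lies in \<open>phase_space Ebar\<close>.\<close>
  ultimately show ?thesis
    using conj
    by (intro exI[of _ "\<lambda>_. state ` orbits"] exI[of _ "\<lambda>_. 1"])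
      (auto simp: iterate_leaves_invariant_def iterate_defined_on_def)
qed

end
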